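(* Let $G$ be a connected chordal graph with at least two maximal cliques. Let $\mathcal C$ be the set of maximal cliques of $G$ and $\mathcal S$ the set of minimal vertex separators of $G$. Then every tree with node set $\mathcal C$ is a clique tree of $G$ if and only if $|\mathcal S|=1$.
   Context: Graphs are finite, simple and undirected. Maximal cliques are regarded as subsets of the vertex set $V$. A minimal vertex separator of $G$ is a set $S\subset V$ such that, for some pair of non-adjacent vertices $a,b$, $S$ separates $a$ from $b$ in $G$ and no proper subset of $S$ does. A clique tree of $G$ is a tree $T=(\mathcal C,\mathcal E)$ with node set $\mathcal C$ such that for all $C_1,C_2\in\mathcal C$ and every $C_3\in\mathcal C$ on the unique path in $T$ between $C_1$ and $C_2$, $C_1\cap C_2\subseteq C_3$. *)

theory Defs
  imports "Graph_Theory.Digraph_Component_Vwalk"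
begin

text \<open>
  A finite simple undirected graph is a \<^term>\<open>pair_graph\<close>: finitely many vertices and a symmetric
  irreflexive set of arcs, an edge being represented by its two opposite arcs.  As a consequence
  the library predicates \<^term>\<open>forest\<close> and \<^term>\<open>tree\<close> cannot be used for undirected graphs (an edge
  traversed back and forth is a directed cycle), so undirected cycles and trees are defined here.
\<close>

text \<open>A cycle is given by the list of its vertices, without repeating the first one at the end.\<close>

definition ucycle :: "'a pair_pre_digraph \<Rightarrow> 'a list \<Rightarrow> bool" where
  "ucycle G p \<longleftrightarrow> vpath p (with_proj G) \<and> 3 \<le> length p \<and> (last p, hd p) \<in> parcs G"

definition has_chord :: "'a pair_pre_digraph \<Rightarrow> 'a list \<Rightarrow> bool" where
  "has_chord G p \<longleftrightarrow>
     (\<exists>u \<in> set p. \<exists>v \<in> set p. (u, v) \<in> parcs G \<and>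
        (u, v) \<notin> set (vwalk_arcs (p @ [hd p])) \<and> (v, u) \<notin> set (vwalk_arcs (p @ [hd p])))"

definition chordal :: "'a pair_pre_digraph \<Rightarrow> bool" where
  "chordal G \<longleftrightarrow> (\<forall>p. ucycle G p \<and> 4 \<le> length p \<longrightarrow> has_chord G p)"

definition utree :: "'a pair_pre_digraph \<Rightarrow> bool" where
  "utree T \<longleftrightarrow> pair_graph T \<and> Digraph_Component.connected (with_proj T) \<and> (\<nexists>p. ucycle T p)"

definition clique :: "'a pair_pre_digraph \<Rightarrow> 'a set \<Rightarrow> bool" where
  "clique G K \<longleftrightarrow> K \<subseteq> pverts G \<and> (\<forall>u \<in> K. \<forall>v \<in> K. u \<noteq> v \<longrightarrow> (u, v) \<in> parcs G)"

definition maximal_cliques :: "'a pair_pre_digraph \<Rightarrow> 'a set set" where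
  "maximal_cliques G = {K. clique G K \<and> (\<forall>K'. clique G K' \<longrightarrow> \<not> K \<subset> K')}"

definition separates :: "'a pair_pre_digraph \<Rightarrow> 'a set \<Rightarrow> 'a \<Rightarrow> 'a \<Rightarrow> bool" where
  "separates G S a b \<longleftrightarrow> S \<subseteq> pverts G \<and> a \<in> pverts G - S \<and> b \<in> pverts G - S \<and>
     \<not> a \<rightarrow>\<^sup>*\<^bsub>induce_subgraph (with_proj G) (pverts G - S)\<^esub> b"

definition minimal_vertex_separators :: "'a pair_pre_digraph \<Rightarrow> 'a set set" where
  "minimal_vertex_separators G =
     {S. \<exists>a \<in> pverts G. \<exists>b \<in> pverts G. a \<noteq> b \<and> (a, b) \<notin> parcs G \<and>
        separates G S a b \<and> (\<forall>S'. S' \<subset> S \<longrightarrow> \<not> separates G S' a b)}"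

text \<open>
  The path between two nodes of a tree is unique, so quantifying over all paths \<open>p\<close> from \<open>C\<^sub>1\<close> to
  \<open>C\<^sub>2\<close> refers to that one path.
\<close>

definition clique_tree :: "'a pair_pre_digraph \<Rightarrow> 'a set pair_pre_digraph \<Rightarrow> bool" where
  "clique_tree G T \<longleftrightarrow> utree T \<and> pverts T = maximal_cliques G \<and>
     (\<forall>C\<^sub>1 \<in> maximal_cliques G. \<forall>C\<^sub>2 \<in> maximal_cliques G. \<forall>C\<^sub>3 \<in> maximal_cliques G. \<forall>p.
        vpath p (with_proj T) \<and> hd p = C\<^sub>1 \<and> last p = C\<^sub>2 \<and> C\<^sub>3 \<in> set p \<longrightarrow> C\<^sub>1 \<inter> C\<^sub>2 \<subseteq> C\<^sub>3)"

end

theory Submission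
  imports Defs
begin

text \<open>
  Both sides are equivalent to the condition that the intersection of any two distinct maximal
  cliques lies in every maximal clique.  For the left-hand side, apply the hypothesis to the star
  centred at a third clique.  For the right-hand side, if the condition holds then the common
  intersection of all maximal cliques is the only minimal separator, since removing it leaves a
  disjoint union of cliques.  Conversely, any two non-adjacent vertices have a minimal separator, so
  a unique minimal separator \<open>S\<close> avoids every vertex that has a non-neighbour: its vertices are
  universal, hence lie in every maximal clique, and a common vertex of two distinct maximal cliques
  is a common neighbour of two non-adjacent vertices, hence lies in \<open>S\<close>.
\<close>

section \<open>Star-shaped trees\<close>

definition star :: "'a set \<Rightarrow> 'a \<Rightarrow> 'a pair_pre_digraph" where
  "star V z = \<lparr>pverts = V, parcs = {(u, v). u \<in> V \<and> v \<in> V \<and> u \<noteq> v \<and> (u = z \<or> v = z)}\<rparr>"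

lemma pverts_star [simp]: "pverts (star V z) = V"
  by (simp add: star_def)

lemma parcs_star: "(u, v) \<in> parcs (star V z) \<longleftrightarrow> u \<in> V \<and> v \<in> V \<and> u \<noteq> v \<and> (u = z \<or> v = z)"
  by (simp add: star_def)

lemma utree_star:
  assumes "finite V" "z \<in> V"
  shows "utree (star V z)"
proof -
  let ?T = "star V z"
  have "parcs ?T \<subseteq> V \<times> V"
    by (auto simp: star_def)
  then have "finite (parcs ?T)"
    using assms(1) finite_subset by blast
  moreover have sym: "symmetric (with_proj ?T)"
    by (auto simp: symmetric_def parcs_star intro!: symI)
  ultimately have graph: "pair_graph ?T"
    using assms(1) by unfold_locales (auto simp: parcs_star)
  then interpret pair_graph ?T .
  have adj: "u \<rightarrow>\<^sup>*\<^bsub>with_proj ?T\<^esub> z" "z \<rightarrow>\<^sup>*\<^bsub>with_proj ?T\<^esub> u" if "u \<in> V" for u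
    using that assms(2) by (cases "u = z"; auto simp: parcs_star intro!: reachable_adjI)+
  have "Digraph_Component.connected (with_proj ?T)"
    unfolding Digraph_Component.connected_def
  \<comment> \<open>Connectedness means strong connectedness of the symmetrised digraph; any two
    nodes are joined through the centre \<open>z\<close>.\<close>
  proof (rule strongly_connectedI)
    show "verts (with_proj (mk_symmetric (with_proj ?T))) \<noteq> {}"
      using assms(2) by auto
    fix u v
    assume "u \<in> verts (with_proj (mk_symmetric (with_proj ?T)))"
      "v \<in> verts (with_proj (mk_symmetric (with_proj ?T)))"
    then have "u \<rightarrow>\<^sup>*\<^bsub>with_proj ?T\<^esub> v"
      using adj reachable_trans by (metis pverts_mk_symmetric pverts_star with_proj_simps(1))
    then show "u \<rightarrow>\<^sup>*\<^bsub>with_proj (mk_symmetric (with_proj ?T))\<^esub> v"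
      by (rule reachable_mk_symmetricI)
  qed
  moreover have False if "ucycle ?T p" for p
  proof -
    have p: "vpath p (with_proj ?T)" "3 \<le> length p" "(last p, hd p) \<in> parcs ?T"
      using that by (auto simp: ucycle_def)
    obtain x y w q where q: "p = x # y # w # q"
      using p(2) by (auto simp: numeral_3_eq_3 Suc_le_length_iff)
    have "distinct p" "(x, y) \<in> parcs ?T" "(y, w) \<in> parcs ?T" "(last (w # q), x) \<in> parcs ?T"
      using p q by (auto simp: vpath_def vwalk_def)
    moreover have "last (w # q) \<in> set (w # q)"
      by (rule last_in_set) simp
    \<comment> \<open>Every arc of the star contains \<open>z\<close>. If \<open>x = z\<close>, the
      arc from \<open>y\<close> to \<open>w\<close> misses it; if \<open>y = z\<close>, the closing
      arc into \<open>x\<close> misses it; otherwise the arc from \<open>x\<close> to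
      \<open>y\<close> does.\<close>
    ultimately show False
      unfolding q parcs_star by (metis distinct.simps(2) list.set_intros)
  qed
  ultimately show ?thesis
    using graph unfolding utree_def by blast
qed

lemma vpath_star:
  assumes "x \<in> V" "y \<in> V" "z \<in> V" "distinct [x, z, y]"
  shows "vpath [x, z, y] (with_proj (star V z))"
  using assms by (auto simp: vpath_def vwalk_def parcs_star)

section \<open>Trees on the set of maximal cliques\<close>

lemma cliques_intersect_if_all_clique_trees:
  assumes fin: "finite (maximal_cliques G)"
    and all: "\<forall>T. utree T \<and> pverts T = maximal_cliques G \<longrightarrow> clique_tree G T"
    and C: "C\<^sub>1 \<in> maximal_cliques G" "C\<^sub>2 \<in> maximal_cliques G" "C\<^sub>3 \<in> maximal_cliques G"
    and "C\<^sub>1 \<noteq> C\<^sub>2"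
  shows "C\<^sub>1 \<inter> C\<^sub>2 \<subseteq> C\<^sub>3"
proof (cases "C\<^sub>3 = C\<^sub>1 \<or> C\<^sub>3 = C\<^sub>2")
  case False
  let ?T = "star (maximal_cliques G) C\<^sub>3"
  have "clique_tree G ?T"
    using all utree_star[OF fin C(3)] by simp
  moreover have "vpath [C\<^sub>1, C\<^sub>3, C\<^sub>2] (with_proj ?T)"
    using False C \<open>C\<^sub>1 \<noteq> C\<^sub>2\<close> by (intro vpath_star) auto
  moreover from calculation(1) have "\<forall>p. vpath p (with_proj ?T) \<and> hd p = C\<^sub>1 \<and> last p = C\<^sub>2 \<and>
      C\<^sub>3 \<in> set p \<longrightarrow> C\<^sub>1 \<inter> C\<^sub>2 \<subseteq> C\<^sub>3"
    unfolding clique_tree_def using C by blast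
  from this[THEN spec, of "[C\<^sub>1, C\<^sub>3, C\<^sub>2]"]
  have "vpath [C\<^sub>1, C\<^sub>3, C\<^sub>2] (with_proj ?T) \<Longrightarrow> C\<^sub>1 \<inter> C\<^sub>2 \<subseteq> C\<^sub>3"
    by simp
  ultimately show ?thesis
    by blast
qed auto

text \<open>The intersection condition does not mention the tree, so it settles every path with
  distinct ends; only paths with equal ends need an argument.\<close>

lemma clique_tree_if_cliques_intersect:
  assumes "utree T" "pverts T = maximal_cliques G"
    and "\<And>C\<^sub>1 C\<^sub>2 C\<^sub>3. C\<^sub>1 \<in> maximal_cliques G \<Longrightarrow> C\<^sub>2 \<in> maximal_cliques G \<Longrightarrow>
      C\<^sub>3 \<in> maximal_cliques G \<Longrightarrow> C\<^sub>1 \<noteq> C\<^sub>2 \<Longrightarrow> C\<^sub>1 \<inter> C\<^sub>2 \<subseteq> C\<^sub>3"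
  shows "clique_tree G T"
proof -
  have path: "hd p \<inter> last p \<subseteq> C"
    if "vpath p (with_proj T)" "C \<in> set p" "hd p \<in> maximal_cliques G" "last p \<in> maximal_cliques G"
      "C \<in> maximal_cliques G" for p C
  proof (cases "hd p = last p")
    case True
    \<comment> \<open>The vertices of a \<open>vpath\<close> are distinct, so equal ends leave a
      single node.\<close>
    then have "p = [hd p]"
      using that(1) by (cases p) (auto simp: vpath_def vwalk_def split: if_splits)
    then have "C = hd p"
      using that(2) by (metis empty_iff empty_set set_ConsD)
    then show ?thesis
      by blast
  next
    case False
    then show ?thesis
      by (intro assms(3) that)
  qed
  show ?thesis
    unfolding clique_tree_def
  proof (intro conjI ballI allI impI)
    fix C\<^sub>1 C\<^sub>2 C\<^sub>3 p
    assume "C\<^sub>1 \<in> maximal_cliques G" "C\<^sub>2 \<in> maximal_cliques G" "C\<^sub>3 \<in> maximal_cliques G"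
      "vpath p (with_proj T) \<and> hd p = C\<^sub>1 \<and> last p = C\<^sub>2 \<and> C\<^sub>3 \<in> set p"
    then show "C\<^sub>1 \<inter> C\<^sub>2 \<subseteq> C\<^sub>3"
      using path[of p C\<^sub>3] by simp
  qed (use assms(1,2) in auto)
qed

text \<open>Otherwise \<open>insert x C\<close> would be a larger clique. Both arc directions are
  demanded because symmetry of \<open>G\<close> is not assumed here.\<close>

lemma maximal_clique_memI:
  assumes "C \<in> maximal_cliques G" "x \<in> pverts G"
    and "\<And>y. y \<in> C \<Longrightarrow> y \<noteq> x \<Longrightarrow> (x, y) \<in> parcs G \<and> (y, x) \<in> parcs G"
  shows "x \<in> C"
proof (rule ccontr)
  assume "x \<notin> C"
  moreover have "clique G (insert x C)"
    using assms by (auto simp: maximal_cliques_def clique_def)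
  ultimately show False
    using assms(1) by (auto simp: maximal_cliques_def)
qed

section \<open>Maximal cliques and separators in a graph\<close>

context pair_graph
begin

lemma arcs_sym: "(u, v) \<in> parcs G \<Longrightarrow> (v, u) \<in> parcs G"
  using graph_symmetric by blast

lemma finite_maximal_cliques: "finite (maximal_cliques G)"
  by (rule finite_subset[of _ "Pow (pverts G)"])
    (auto simp: maximal_cliques_def clique_def pair_finite_verts)

lemma clique_subset_maximal_clique:
  assumes "clique G K"
  obtains C where "C \<in> maximal_cliques G" "K \<subseteq> C"
proof -
  have "finite {K. clique G K}"
    by (rule finite_subset[of _ "Pow (pverts G)"]) (auto simp: clique_def pair_finite_verts)
  from finite_has_maximal2[OF this, of K] show ?thesis
    using assms that by (auto simp: maximal_cliques_def)
qed

text \<open>Maximal cliques are incomparable, which gives \<open>a\<close> outside the second one;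
  if \<open>a\<close> were adjacent to all of that clique, maximality would absorb it.\<close>

lemma distinct_maximal_cliques_nonadjacent:
  assumes "C\<^sub>1 \<in> maximal_cliques G" "C\<^sub>2 \<in> maximal_cliques G" "C\<^sub>1 \<noteq> C\<^sub>2"
  obtains a b where "a \<in> C\<^sub>1" "b \<in> C\<^sub>2" "a \<noteq> b" "(a, b) \<notin> parcs G"
proof -
  obtain a where a: "a \<in> C\<^sub>1" "a \<notin> C\<^sub>2"
    using assms by (auto simp: maximal_cliques_def)
  then have "a \<in> pverts G"
    using assms(1) by (auto simp: maximal_cliques_def clique_def)
  then have "\<exists>b\<in>C\<^sub>2. b \<noteq> a \<and> (a, b) \<notin> parcs G"
    using maximal_clique_memI[OF assms(2)] a(2) arcs_sym by blast
  then show ?thesis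
    using that a(1) by blast
qed

text \<open>A walk from \<open>a\<close> that avoids \<open>S\<close> can never leave
  \<open>A\<close>. The set \<open>A\<close> may meet \<open>S\<close>, so a whole maximal clique
  can serve as \<open>A\<close>.\<close>

lemma separatesI:
  assumes "S \<subseteq> pverts G" "a \<in> A" "a \<in> pverts G - S" "b \<in> pverts G - S" "b \<notin> A"
    and closed: "\<And>u v. u \<in> A - S \<Longrightarrow> v \<notin> S \<Longrightarrow> (u, v) \<in> parcs G \<Longrightarrow> v \<in> A"
  shows "separates G S a b"
proof -
  let ?H = "induce_subgraph (with_proj G) (pverts G - S)"
  have "v \<in> A - S" if "a \<rightarrow>\<^sup>*\<^bsub>?H\<^esub> v" for v
    using that unfolding reachable_def
  proof (induction rule: rtrancl_on_induct)
    case base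
    then show ?case using assms by auto
  next
    case (step u v)
    then have "(u, v) \<in> parcs G" "v \<notin> S"
      by (auto simp: arcs_ends_conv)
    then show ?case using closed step by blast
  qed
  then show ?thesis
    using assms unfolding separates_def by blast
qed

lemma mem_separator_if_common_neighbour:
  assumes "separates G S a b" "(a, x) \<in> parcs G" "(x, b) \<in> parcs G"
  shows "x \<in> S"
proof (rule ccontr)
  assume "x \<notin> S"
  let ?H = "induce_subgraph (with_proj G) (pverts G - S)"
  interpret H: wf_digraph ?H
    by (rule wellformed_induce_subgraph)
  have "a \<rightarrow>\<^bsub>?H\<^esub> x" "x \<rightarrow>\<^bsub>?H\<^esub> b"
    using assms \<open>x \<notin> S\<close> in_arcsD1 in_arcsD2
    by (force simp: arcs_ends_conv separates_def)+
  then have "a \<rightarrow>\<^sup>*\<^bsub>?H\<^esub> b"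
    using H.reachable_adjI H.reachable_trans by blast
  then show False
    using assms(1) by (simp add: separates_def)
qed

text \<open>Deleting all other vertices separates \<open>a\<close> from \<open>b\<close>; by
  finiteness there is an inclusion-minimal set among all separators of this pair.\<close>

lemma nonadjacent_minimal_separator:
  assumes "a \<in> pverts G" "b \<in> pverts G" "a \<noteq> b" "(a, b) \<notin> parcs G"
  obtains S where "S \<in> minimal_vertex_separators G" "separates G S a b"
proof -
  have "separates G (pverts G - {a, b}) a b"
  proof (rule separatesI[of _ a "{a}"])
    fix u v
    assume "u \<in> {a} - (pverts G - {a, b})" "v \<notin> pverts G - {a, b}" "(u, v) \<in> parcs G"
    then show "v \<in> {a}"
      using assms(4) in_arcsD2 by blast
  qed (use assms in auto)
  moreover have "finite {S. separates G S a b}"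
    by (rule finite_subset[of _ "Pow (pverts G)"]) (auto simp: separates_def pair_finite_verts)
  ultimately obtain S where "separates G S a b" "\<forall>S'. separates G S' a b \<longrightarrow> S' \<subseteq> S \<longrightarrow> S = S'"
    using finite_has_minimal[of "{S. separates G S a b}"] by (metis empty_iff mem_Collect_eq)
  then show ?thesis
    using that assms unfolding minimal_vertex_separators_def by blast
qed

section \<open>Unique minimal separators and intersections of cliques\<close>

lemma cliques_intersect_if_unique_separator:
  assumes S: "minimal_vertex_separators G = {S}"
    and C: "C\<^sub>1 \<in> maximal_cliques G" "C\<^sub>2 \<in> maximal_cliques G" "C\<^sub>3 \<in> maximal_cliques G"
    and "C\<^sub>1 \<noteq> C\<^sub>2"
  shows "C\<^sub>1 \<inter> C\<^sub>2 \<subseteq> C\<^sub>3"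
proof -
  have sep: "separates G S a b"
    if "a \<in> pverts G" "b \<in> pverts G" "a \<noteq> b" "(a, b) \<notin> parcs G" for a b
    by (rule nonadjacent_minimal_separator[OF that]) (simp add: S)
  \<comment> \<open>A non-neighbour \<open>v\<close> of \<open>s\<close> would make \<open>S\<close>
    separate \<open>s\<close> from \<open>v\<close>, which forces \<open>s\<close> outside
    \<open>S\<close>.\<close>
  then have universal: "(s, v) \<in> parcs G" if "s \<in> S" "s \<in> pverts G" "v \<in> pverts G" "s \<noteq> v" for s v
    using that sep[of s v] by (auto simp: separates_def)
  have "s \<in> C\<^sub>3" if s: "s \<in> S" "s \<in> pverts G" for s
  proof (rule maximal_clique_memI[OF C(3) s(2)])
    fix v
    assume v: "v \<in> C\<^sub>3" "v \<noteq> s"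
    then have "v \<in> pverts G"
      using C(3) by (auto simp: maximal_cliques_def clique_def)
    then show "(s, v) \<in> parcs G \<and> (v, s) \<in> parcs G"
      using universal[OF s] v(2) arcs_sym by blast
  qed
  moreover have "C\<^sub>1 \<inter> C\<^sub>2 \<subseteq> S"
  proof
    fix x
    assume x: "x \<in> C\<^sub>1 \<inter> C\<^sub>2"
    obtain a b where ab: "a \<in> C\<^sub>1" "b \<in> C\<^sub>2" "a \<noteq> b" "(a, b) \<notin> parcs G"
      using distinct_maximal_cliques_nonadjacent[OF C(1,2) \<open>C\<^sub>1 \<noteq> C\<^sub>2\<close>] .
    have sub: "C\<^sub>1 \<subseteq> pverts G" "C\<^sub>2 \<subseteq> pverts G"
      and adj: "\<And>u v. u \<in> C\<^sub>1 \<Longrightarrow> v \<in> C\<^sub>1 \<Longrightarrow> u \<noteq> v \<Longrightarrow> (u, v) \<in> parcs G"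
        "\<And>u v. u \<in> C\<^sub>2 \<Longrightarrow> v \<in> C\<^sub>2 \<Longrightarrow> u \<noteq> v \<Longrightarrow> (u, v) \<in> parcs G"
      using C by (auto simp: maximal_cliques_def clique_def)
    \<comment> \<open>If \<open>x\<close> were \<open>a\<close> or \<open>b\<close>, then
      \<open>a\<close> and \<open>b\<close> would share a clique and be adjacent.\<close>
    have "x \<noteq> a" "x \<noteq> b"
      using x ab adj by blast+
    have "separates G S a b"
      using ab sub by (intro sep) auto
    moreover have "(a, x) \<in> parcs G" "(x, b) \<in> parcs G"
      using ab x adj \<open>x \<noteq> a\<close> \<open>x \<noteq> b\<close> by blast+
    ultimately show "x \<in> S"
      by (rule mem_separator_if_common_neighbour)
  qed
  moreover have "C\<^sub>1 \<subseteq> pverts G"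
    using C by (auto simp: maximal_cliques_def clique_def)
  ultimately show ?thesis
    by blast
qed

text \<open>For each non-adjacent pair, the common intersection is the least separator, not merely a
  minimal one. The two given cliques supply such a pair.\<close>

lemma unique_separator_if_cliques_intersect:
  assumes X: "\<And>C\<^sub>1 C\<^sub>2 C\<^sub>3. C\<^sub>1 \<in> maximal_cliques G \<Longrightarrow> C\<^sub>2 \<in> maximal_cliques G \<Longrightarrow>
      C\<^sub>3 \<in> maximal_cliques G \<Longrightarrow> C\<^sub>1 \<noteq> C\<^sub>2 \<Longrightarrow> C\<^sub>1 \<inter> C\<^sub>2 \<subseteq> C\<^sub>3"
    and two: "D\<^sub>1 \<in> maximal_cliques G" "D\<^sub>2 \<in> maximal_cliques G" "D\<^sub>1 \<noteq> D\<^sub>2"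
  shows "minimal_vertex_separators G = {\<Inter>(maximal_cliques G)}"
proof -
  let ?I = "\<Inter>(maximal_cliques G)"
  have cliqueD: "(u, v) \<in> parcs G"
    if "C \<in> maximal_cliques G" "u \<in> C" "v \<in> C" "u \<noteq> v" for C u v
    using that by (auto simp: maximal_cliques_def clique_def)
  \<comment> \<open>The case \<open>u = v\<close> yields a maximal clique through any single
    vertex.\<close>
  have in_clique: "\<exists>C\<in>maximal_cliques G. u \<in> C \<and> v \<in> C"
    if "(u, v) \<in> parcs G \<or> u = v" "u \<in> pverts G" "v \<in> pverts G" for u v
  proof -
    have "clique G {u, v}"
      using that arcs_sym by (auto simp: clique_def)
    then obtain C where "C \<in> maximal_cliques G" "{u, v} \<subseteq> C"
      by (rule clique_subset_maximal_clique)
    then show ?thesis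
      by blast
  qed
  have I_subset: "?I \<subseteq> pverts G"
    using two(1) by (auto simp: maximal_cliques_def clique_def)
  have universal: "(s, v) \<in> parcs G" if sv: "s \<in> ?I" "v \<in> pverts G" "s \<noteq> v" for s v
  proof -
    obtain C where "C \<in> maximal_cliques G" "v \<in> C"
      using in_clique[of v v] sv(2) by blast
    then show ?thesis
      using sv by (intro cliqueD[of C]) auto
  qed
  have sep: "separates G ?I a b"
    and least: "\<And>S. separates G S a b \<Longrightarrow> ?I \<subseteq> S"
    if ab: "a \<in> pverts G" "b \<in> pverts G" "a \<noteq> b" "(a, b) \<notin> parcs G" for a b
  proof -
    obtain C where C: "C \<in> maximal_cliques G" "a \<in> C"
      using in_clique[of a a] ab by blast
    have notin: "a \<notin> ?I" "b \<notin> ?I"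
      using universal[of a b] universal[of b a] ab arcs_sym by metis+
    show "separates G ?I a b"
    \<comment> \<open>Outside \<open>?I\<close> the maximal cliques are disjoint, so
      \<open>C\<close> confines all walks from \<open>a\<close>.\<close>
    proof (rule separatesI[of _ a C])
      fix u v
      assume u: "u \<in> C - ?I" "(u, v) \<in> parcs G"
      then obtain C' where C': "C' \<in> maximal_cliques G" "u \<in> C'" "v \<in> C'"
        using in_clique[of u v] in_arcsD1 in_arcsD2 by blast
      \<comment> \<open>Were the two cliques distinct, their common vertex \<open>u\<close> would
        lie in every maximal clique by \<open>X\<close>, hence in \<open>?I\<close>.\<close>
      then have "C' = C"
        using X[OF C(1) C'(1)] u(1) C'(2) by blast
      then show "v \<in> C"
        using C'(3) by simp
    next
      show "b \<notin> C"
        using cliqueD[OF C] ab by blast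
    qed (use I_subset C notin ab in simp_all)
    show "?I \<subseteq> S" if "separates G S a b" for S
    proof
      fix x
      assume x: "x \<in> ?I"
      then have "x \<noteq> a" "x \<noteq> b"
        using notin by metis+
      \<comment> \<open>A universal vertex is a common neighbour of \<open>a\<close> and
        \<open>b\<close>, so every separator of them contains it.\<close>
      then have "(a, x) \<in> parcs G" "(x, b) \<in> parcs G"
        using universal[OF x] ab arcs_sym by blast+
      then show "x \<in> S"
        by (rule mem_separator_if_common_neighbour[OF that])
    qed
  qed
  have eq: "S = ?I" if "S \<in> minimal_vertex_separators G" for S
  proof -
    obtain a b where "a \<in> pverts G" "b \<in> pverts G" "a \<noteq> b" "(a, b) \<notin> parcs G"
      "separates G S a b" "\<forall>S'. S' \<subset> S \<longrightarrow> \<not> separates G S' a b"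
      using \<open>S \<in> minimal_vertex_separators G\<close> unfolding minimal_vertex_separators_def by blast
    then show ?thesis
      using sep[of a b] least[of a b S] by blast
  qed
  obtain a b where ab: "a \<in> D\<^sub>1" "b \<in> D\<^sub>2" "a \<noteq> b" "(a, b) \<notin> parcs G"
    using distinct_maximal_cliques_nonadjacent[OF two] .
  have "a \<in> pverts G" "b \<in> pverts G"
    using ab two by (auto simp: maximal_cliques_def clique_def)
  then obtain S where "S \<in> minimal_vertex_separators G"
    using ab by (metis nonadjacent_minimal_separator)
  then show ?thesis
    using eq by blast
qed

end

theorem theorem5p1:
  fixes G :: "'a pair_pre_digraph"
  assumes "pair_graph G"
    and "Digraph_Component.connected (with_proj G)"
    and "chordal G"
    and "2 \<le> card (maximal_cliques G)"
  shows "(\<forall>T. utree T \<and> pverts T = maximal_cliques G \<longrightarrow> clique_tree G T)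
           \<longleftrightarrow> card (minimal_vertex_separators G) = 1"
proof -
  interpret pair_graph G
    by (fact assms(1))
  obtain D\<^sub>1 D\<^sub>2 where two: "D\<^sub>1 \<in> maximal_cliques G" "D\<^sub>2 \<in> maximal_cliques G" "D\<^sub>1 \<noteq> D\<^sub>2"
    using assms(4) by (auto simp: numeral_2_eq_2 card_le_Suc_iff)
  show ?thesis
  proof
    assume all: "\<forall>T. utree T \<and> pverts T = maximal_cliques G \<longrightarrow> clique_tree G T"
    have "minimal_vertex_separators G = {\<Inter>(maximal_cliques G)}"
      by (rule unique_separator_if_cliques_intersect[OF _ two])
        (rule cliques_intersect_if_all_clique_trees[OF finite_maximal_cliques all])
    then show "card (minimal_vertex_separators G) = 1"
      by simp
  next
    assume "card (minimal_vertex_separators G) = 1"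
    then obtain S where "minimal_vertex_separators G = {S}"
      by (auto simp: card_1_singleton_iff)
    then show "\<forall>T. utree T \<and> pverts T = maximal_cliques G \<longrightarrow> clique_tree G T"
      by (intro allI impI clique_tree_if_cliques_intersect)
        (simp_all add: cliques_intersect_if_unique_separator)
  qed
qed

end
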